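(* Let $\tilde{\boldsymbol y}\in[0,1]^m$ be fixed, and for each $j\in J_Q$ let $i(j)\in\arg\min_{i\in I_j}\{1-(1-p_{ij})\tilde y_i\}$ be any selected minimizer. Define $$\tilde\alpha_{ij}=\begin{cases}d_j,&\text{if } j\in J_Q\text{ and } i=i(j),\\ 0,&\text{otherwise,}\end{cases}\quad j\in J,\ i\in I_j,\qquad \tilde\gamma_j=\begin{cases}0,&\text{if } j\in J_Q,\\ d_j,&\text{if } j\in J_N,\end{cases}\quad j\in J.$$ Then $(\tilde{\boldsymbol\alpha},\tilde{\boldsymbol\gamma})$ is an optimal solution of the linear program $$\begin{aligned}\min\ &\sum_{j\in J}\Bigl[\sum_{i\in I_j}\bigl(1-(1-p_{ij})\tilde y_i\bigr)\alpha_{ij}+\Bigl(\sum_{i\in I_j}p_{ij}\tilde y_i\Bigr)\gamma_j\Bigr]\\ \text{subject to }\ &\sum_{i\in I_j}\alpha_{ij}+\gamma_j\ge d_j,\quad j\in J,\\ &\alpha_{ij}\ge 0,\quad j\in J,\ i\in I_j,\\ &\gamma_j\ge 0,\quad j\in J.\end{aligned}$$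
   Context: $I=\{1,\dots,m\}$ is a finite set of candidate locations, $J=\{1,\dots,n\}$ a finite set of customers, $d_j>0$ the weight of customer $j$, $p_{ij}\in[0,1]$ the coverage level provided by location $i$ to customer $j$, and $I_j=\{i\in I:0<p_{ij}\le 1\}$ (possibly empty). For the fixed vector $\tilde{\boldsymbol y}\in[0,1]^m$ define, for each $j\in J$, $\tilde Q_j=\min_{i\in I_j}\{1-(1-p_{ij})\tilde y_i\}$ if $I_j\ne\varnothing$ and $\tilde Q_j=1$ if $I_j=\varnothing$; and $\tilde N_j=\sum_{i\in I_j}p_{ij}\tilde y_i$ (empty sum equal to $0$). Let $J_Q=\{j\in J:\tilde Q_j<\tilde N_j\}$ and $J_N=\{j\in J:\tilde N_j\le\tilde Q_j\}$. (If $j\in J_Q$ then $I_j\neq\varnothing$.) The linear program in the claim is the LP dual of the projection problem $\max\{\sum_{j\in J}d_jr_j:\ r_j\le 1-(1-p_{ij})\tilde y_i\ (j\in J, i\in I_j),\ r_j\le\sum_{i\in I_j}p_{ij}\tilde y_i\ (j\in J),\ r_j\ge 0\ (j\in J)\}$. *)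

theory Defs
  imports Complex_Main
begin

text \<open>
  Locations are \<open>{1..m}\<close> and customers \<open>{1..n}\<close>. Data and solutions are total functions
  (\<open>p i j\<close>, \<open>\<alpha> i j\<close> with the location first); their values off the index sets never matter:
  \<open>\<alpha> i j\<close> is an LP variable only for \<open>j \<in> {1..n}\<close> and \<open>i \<in> cover_set m p j\<close>.
\<close>

definition cover_set :: "nat \<Rightarrow> (nat \<Rightarrow> nat \<Rightarrow> real) \<Rightarrow> nat \<Rightarrow> nat set" where
  "cover_set m p j = {i \<in> {1..m}. 0 < p i j \<and> p i j \<le> 1}"

definition Q_val :: "nat \<Rightarrow> (nat \<Rightarrow> nat \<Rightarrow> real) \<Rightarrow> (nat \<Rightarrow> real) \<Rightarrow> nat \<Rightarrow> real" where
  "Q_val m p y j =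
     (if cover_set m p j = {} then 1
      else Min ((\<lambda>i. 1 - (1 - p i j) * y i) ` cover_set m p j))"

definition N_val :: "nat \<Rightarrow> (nat \<Rightarrow> nat \<Rightarrow> real) \<Rightarrow> (nat \<Rightarrow> real) \<Rightarrow> nat \<Rightarrow> real" where
  "N_val m p y j = (\<Sum>i\<in>cover_set m p j. p i j * y i)"

definition J_Q :: "nat \<Rightarrow> nat \<Rightarrow> (nat \<Rightarrow> nat \<Rightarrow> real) \<Rightarrow> (nat \<Rightarrow> real) \<Rightarrow> nat set" where
  "J_Q m n p y = {j \<in> {1..n}. Q_val m p y j < N_val m p y j}"

definition J_N :: "nat \<Rightarrow> nat \<Rightarrow> (nat \<Rightarrow> nat \<Rightarrow> real) \<Rightarrow> (nat \<Rightarrow> real) \<Rightarrow> nat set" where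
  "J_N m n p y = {j \<in> {1..n}. N_val m p y j \<le> Q_val m p y j}"

definition lp_objective ::
  "nat \<Rightarrow> nat \<Rightarrow> (nat \<Rightarrow> nat \<Rightarrow> real) \<Rightarrow> (nat \<Rightarrow> real) \<Rightarrow> (nat \<Rightarrow> nat \<Rightarrow> real) \<Rightarrow> (nat \<Rightarrow> real) \<Rightarrow> real" where
  "lp_objective m n p y \<alpha> \<gamma> =
     (\<Sum>j = 1..n. (\<Sum>i\<in>cover_set m p j. (1 - (1 - p i j) * y i) * \<alpha> i j)
                + (\<Sum>i\<in>cover_set m p j. p i j * y i) * \<gamma> j)"

definition lp_feasible ::
  "nat \<Rightarrow> nat \<Rightarrow> (nat \<Rightarrow> nat \<Rightarrow> real) \<Rightarrow> (nat \<Rightarrow> real) \<Rightarrow> (nat \<Rightarrow> nat \<Rightarrow> real) \<Rightarrow> (nat \<Rightarrow> real) \<Rightarrow> bool" where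
  "lp_feasible m n p d \<alpha> \<gamma> \<longleftrightarrow>
     (\<forall>j\<in>{1..n}. (\<Sum>i\<in>cover_set m p j. \<alpha> i j) + \<gamma> j \<ge> d j) \<and>
     (\<forall>j\<in>{1..n}. \<forall>i\<in>cover_set m p j. \<alpha> i j \<ge> 0) \<and>
     (\<forall>j\<in>{1..n}. \<gamma> j \<ge> 0)"

definition lp_optimal ::
  "nat \<Rightarrow> nat \<Rightarrow> (nat \<Rightarrow> nat \<Rightarrow> real) \<Rightarrow> (nat \<Rightarrow> real) \<Rightarrow> (nat \<Rightarrow> real) \<Rightarrow>
   (nat \<Rightarrow> nat \<Rightarrow> real) \<Rightarrow> (nat \<Rightarrow> real) \<Rightarrow> bool" where
  "lp_optimal m n p d y \<alpha> \<gamma> \<longleftrightarrow>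
     lp_feasible m n p d \<alpha> \<gamma> \<and>
     (\<forall>\<alpha>' \<gamma>'. lp_feasible m n p d \<alpha>' \<gamma>' \<longrightarrow>
        lp_objective m n p y \<alpha> \<gamma> \<le> lp_objective m n p y \<alpha>' \<gamma>')"

definition alpha_sol ::
  "nat \<Rightarrow> nat \<Rightarrow> (nat \<Rightarrow> nat \<Rightarrow> real) \<Rightarrow> (nat \<Rightarrow> real) \<Rightarrow> (nat \<Rightarrow> real) \<Rightarrow> (nat \<Rightarrow> nat) \<Rightarrow>
   nat \<Rightarrow> nat \<Rightarrow> real" where
  "alpha_sol m n p d y sel i j = (if j \<in> J_Q m n p y \<and> i = sel j then d j else 0)"

text \<open>The final \<open>0\<close> is reached only for \<open>j \<notin> {1..n}\<close>.\<close>

definition gamma_sol ::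
  "nat \<Rightarrow> nat \<Rightarrow> (nat \<Rightarrow> nat \<Rightarrow> real) \<Rightarrow> (nat \<Rightarrow> real) \<Rightarrow> (nat \<Rightarrow> real) \<Rightarrow> nat \<Rightarrow> real" where
  "gamma_sol m n p d y j =
     (if j \<in> J_Q m n p y then 0 else if j \<in> J_N m n p y then d j else 0)"

end

theory Submission
  imports Defs
begin

text \<open>
  The dual program has no constraint linking two customers, so it splits into one small
  problem per customer \<open>j\<close>: buy at least \<open>d j\<close> units in total, where the unit prices on offer are
  \<open>1 - (1 - p i j) * y i\<close> for each \<open>i\<close> covering \<open>j\<close>, and additionally \<open>N_val m p y j\<close>. The cheapest
  price on offer is \<open>min (Q_val m p y j) (N_val m p y j)\<close>. Because \<open>p\<close> and \<open>y\<close> take values in the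
  unit interval, this price is nonnegative, so no purchase can cost less than \<open>d j\<close> times it
  (\<open>covering_cost_lower_bound\<close>, weak duality for a single covering constraint). The proposed
  solution buys exactly \<open>d j\<close> units at a cheapest price (\<open>customer_cost_of_solution\<close>), hence attains
  the bound for every customer and therefore for the sum.

  The number \<open>min (Q_val m p y j) (N_val m p y j)\<close> is also the optimal \<open>r j\<close> in the projection
  problem, so the argument certifies optimality by exhibiting equal primal and dual values. When
  no location covers \<open>j\<close>, the convention \<open>Q_val m p y j = 1\<close> is harmless: then
  \<open>N_val m p y j = 0\<close>, so the minimum is still a price on offer.
\<close>

lemma finite_cover_set [simp]: "finite (cover_set m p j)"
  by (simp add: cover_set_def)

lemma N_val_nonneg:
  assumes "\<And>i. i \<in> {1..m} \<Longrightarrow> y i \<in> {0..1::real}"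
  shows "0 \<le> N_val m p y j"
  unfolding N_val_def using assms by (intro sum_nonneg) (auto simp: cover_set_def)

lemma Q_val_le:
  assumes "i \<in> cover_set m p j"
  shows "Q_val m p y j \<le> 1 - (1 - p i j) * y i"
  using assms by (auto simp: Q_val_def intro!: Min_le)

lemma Q_val_nonneg:
  assumes "\<And>i. i \<in> {1..m} \<Longrightarrow> y i \<in> {0..1::real}"
  shows "0 \<le> Q_val m p y j"
proof -
  have "(1 - p i j) * y i \<le> 1" if "i \<in> cover_set m p j" for i
    using that assms[of i] by (intro mult_le_one) (auto simp: cover_set_def)
  then show ?thesis
    by (auto simp: Q_val_def)
qed

lemma Q_val_eq_arg_min:
  assumes "is_arg_min (\<lambda>i. 1 - (1 - p i j) * y i) (\<lambda>i. i \<in> cover_set m p j) k"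
  shows "Q_val m p y j = 1 - (1 - p k j) * y k"
proof -
  have k: "k \<in> cover_set m p j"
    and least: "\<And>i. i \<in> cover_set m p j \<Longrightarrow> 1 - (1 - p k j) * y k \<le> 1 - (1 - p i j) * y i"
    using assms by (auto simp: is_arg_min_linorder)
  have "Min ((\<lambda>i. 1 - (1 - p i j) * y i) ` cover_set m p j) = 1 - (1 - p k j) * y k"
    using k least by (intro Min_eqI) auto
  then show ?thesis
    using k by (auto simp: Q_val_def)
qed

text \<open>
  Weak duality for a single covering constraint: \<open>t\<close> is a feasible dual multiplier as it is
  below every price. Its nonnegativity matters because the constraint is an inequality; with a
  negative price, overbuying would pay.
\<close>

lemma covering_cost_lower_bound:
  fixes a c :: "'a \<Rightarrow> real"
  assumes "(\<Sum>i\<in>S. a i) + g \<ge> b"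
    and "\<And>i. i \<in> S \<Longrightarrow> 0 \<le> a i" and "0 \<le> g"
    and "0 \<le> t" and "\<And>i. i \<in> S \<Longrightarrow> t \<le> c i" and "t \<le> N"
  shows "t * b \<le> (\<Sum>i\<in>S. c i * a i) + N * g"
proof -
  have "t * b \<le> t * ((\<Sum>i\<in>S. a i) + g)"
    using assms by (intro mult_left_mono) auto
  also have "\<dots> = (\<Sum>i\<in>S. t * a i) + t * g"
    by (simp add: distrib_left sum_distrib_left)
  also have "\<dots> \<le> (\<Sum>i\<in>S. c i * a i) + N * g"
    using assms by (intro add_mono sum_mono mult_right_mono) auto
  finally show ?thesis .
qed

text \<open>
  The selected location carries the whole weight, at unit price \<open>Q_val m p y j\<close>, when that is the
  smaller of the two; otherwise everything is bought at unit price \<open>N_val m p y j\<close>.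
\<close>

lemma customer_cost_of_solution:
  assumes j: "j \<in> {1..n}"
    and sel: "j \<in> J_Q m n p y \<Longrightarrow>
      is_arg_min (\<lambda>i. 1 - (1 - p i j) * y i) (\<lambda>i. i \<in> cover_set m p j) (sel j)"
  shows "(\<Sum>i\<in>cover_set m p j. (1 - (1 - p i j) * y i) * alpha_sol m n p d y sel i j)
           + N_val m p y j * gamma_sol m n p d y j
         = min (Q_val m p y j) (N_val m p y j) * d j"
proof (cases "j \<in> J_Q m n p y")
  case True
  have k: "sel j \<in> cover_set m p j"
    using sel[OF True] by (simp add: is_arg_min_def)
  have "(\<Sum>i\<in>cover_set m p j. (1 - (1 - p i j) * y i) * alpha_sol m n p d y sel i j)
      = (\<Sum>i\<in>cover_set m p j. if i = sel j then (1 - (1 - p i j) * y i) * d j else 0)"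
    using True by (intro sum.cong) (auto simp: alpha_sol_def)
  also have "\<dots> = Q_val m p y j * d j"
    using k Q_val_eq_arg_min[OF sel[OF True]] by (simp add: sum.delta)
  finally show ?thesis
    using True by (simp add: gamma_sol_def J_Q_def)
next
  case False
  then have "j \<in> J_N m n p y"
    using j by (auto simp: J_Q_def J_N_def)
  then show ?thesis
    using False by (simp add: alpha_sol_def gamma_sol_def J_N_def)
qed

lemma solution_feasible:
  assumes d_nonneg: "\<And>j. j \<in> {1..n} \<Longrightarrow> 0 \<le> d j"
    and sel: "\<And>j. j \<in> J_Q m n p y \<Longrightarrow> sel j \<in> cover_set m p j"
  shows "lp_feasible m n p d (alpha_sol m n p d y sel) (gamma_sol m n p d y)"
proof -
  have "(\<Sum>i\<in>cover_set m p j. alpha_sol m n p d y sel i j) + gamma_sol m n p d y j = d j"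
    if j: "j \<in> {1..n}" for j
  proof (cases "j \<in> J_Q m n p y")
    case True
    then show ?thesis
      using sel[OF True] by (simp add: alpha_sol_def gamma_sol_def sum.delta)
  next
    case False
    then have "j \<in> J_N m n p y"
      using j by (auto simp: J_Q_def J_N_def)
    then show ?thesis
      using False by (simp add: alpha_sol_def gamma_sol_def)
  qed
  then show ?thesis
    using d_nonneg by (simp add: lp_feasible_def alpha_sol_def gamma_sol_def)
qed

theorem proposition3:
  fixes m n :: nat
    and d :: "nat \<Rightarrow> real"
    and p :: "nat \<Rightarrow> nat \<Rightarrow> real"
    and y :: "nat \<Rightarrow> real"
    and sel :: "nat \<Rightarrow> nat"
  assumes d_pos: "\<And>j. j \<in> {1..n} \<Longrightarrow> 0 < d j"
    and p_range: "\<And>i j. i \<in> {1..m} \<Longrightarrow> j \<in> {1..n} \<Longrightarrow> p i j \<in> {0..1}"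
    and y_range: "\<And>i. i \<in> {1..m} \<Longrightarrow> y i \<in> {0..1}"
    and sel_argmin: "\<And>j. j \<in> J_Q m n p y \<Longrightarrow>
      is_arg_min (\<lambda>i. 1 - (1 - p i j) * y i) (\<lambda>i. i \<in> cover_set m p j) (sel j)"
  shows "lp_optimal m n p d y (alpha_sol m n p d y sel) (gamma_sol m n p d y)"
proof -
  have feasible: "lp_feasible m n p d (alpha_sol m n p d y sel) (gamma_sol m n p d y)"
  proof (rule solution_feasible)
    show "0 \<le> d j" if "j \<in> {1..n}" for j
      using d_pos[OF that] by simp
    show "sel j \<in> cover_set m p j" if "j \<in> J_Q m n p y" for j
      using sel_argmin[OF that] by (simp add: is_arg_min_def)
  qed
  have "lp_objective m n p y (alpha_sol m n p d y sel) (gamma_sol m n p d y)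
      \<le> lp_objective m n p y \<alpha> \<gamma>" if feas: "lp_feasible m n p d \<alpha> \<gamma>" for \<alpha> \<gamma>
    unfolding lp_objective_def N_val_def[symmetric]
  proof (rule sum_mono)
    fix j assume j: "j \<in> {1..n}"
    have "min (Q_val m p y j) (N_val m p y j) * d j
        \<le> (\<Sum>i\<in>cover_set m p j. (1 - (1 - p i j) * y i) * \<alpha> i j) + N_val m p y j * \<gamma> j"
    proof (rule covering_cost_lower_bound)
      show "0 \<le> min (Q_val m p y j) (N_val m p y j)"
        using Q_val_nonneg[OF y_range] N_val_nonneg[OF y_range] by simp
      show "min (Q_val m p y j) (N_val m p y j) \<le> 1 - (1 - p i j) * y i"
        if "i \<in> cover_set m p j" for i
        using Q_val_le[OF that] by (rule min.coboundedI1)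
    qed (use feas j in \<open>auto simp: lp_feasible_def\<close>)
    then show "(\<Sum>i\<in>cover_set m p j. (1 - (1 - p i j) * y i) * alpha_sol m n p d y sel i j)
          + N_val m p y j * gamma_sol m n p d y j
        \<le> (\<Sum>i\<in>cover_set m p j. (1 - (1 - p i j) * y i) * \<alpha> i j) + N_val m p y j * \<gamma> j"
      by (simp only: customer_cost_of_solution[where sel = sel, OF j sel_argmin])
  qed
  with feasible show ?thesis
    by (simp add: lp_optimal_def)
qed

end
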